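(* For any $P\in\mathcal{P}_d$, the expectile depth $ED(z,P)$ is uniquely maximised (over $z\in\mathbb{R}^d$) at $z=\mu_P:=\mathrm{E}[Z]$, where $Z$ is a random $d$-vector with distribution $P$, and the corresponding maximum depth is $ED(\mu_P,P)=1/2$.
   Context: A prime denotes transposition, $\mathbb{I}[A]$ is the indicator of $A$, and $\mathcal{S}^{d-1}=\{z\in\mathbb{R}^d:\|z\|=1\}$. $\mathcal{P}_d$ is the collection of probability measures over $\mathbb{R}^d$ that do not give probability one to any hyperplane of $\mathbb{R}^d$ (for $d=1$, to any singleton) and that have finite first-order moments. For $P\in\mathcal{P}_d$ and $z\in\mathbb{R}^d$, the expectile depth of $z$ with respect to $P$ is $$ED(z,P)=\inf_{u\in\mathcal{S}^{d-1}}\frac{\mathrm{E}[|u'(Z-z)|\,\mathbb{I}[u'(Z-z)\leq0]]}{\mathrm{E}[|u'(Z-z)|]},\qquad Z\sim P.$$ *)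

theory Defs
  imports "HOL-Probability.Probability"
begin

text \<open>Probability measures are Borel measures on \<open>real ^ 'd\<close>; a hyperplane is the solution set of
  \<open>inner u x = c\<close> with \<open>u \<noteq> 0\<close>, which is a singleton in dimension one.\<close>

definition nondegenerate_measures :: "(real ^ 'd) measure set" where
  "nondegenerate_measures = {P. prob_space P \<and> sets P = sets borel \<and>
     (\<forall>(u :: real ^ 'd) c. u \<noteq> 0 \<longrightarrow> measure P {x. inner u x = c} \<noteq> 1) \<and>
     integrable P (\<lambda>x. x)}"

text \<open>For \<open>P \<in> nondegenerate_measures\<close> the denominator is positive, so no division by zero occurs,
  and the ratios lie in \<open>{0..1}\<close>, so the real infimum is the usual one.\<close>

definition expectile_depth :: "real ^ 'd \<Rightarrow> (real ^ 'd) measure \<Rightarrow> real" where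
  "expectile_depth z P = (INF u \<in> sphere 0 1.
     (\<integral>x. \<bar>inner u (x - z)\<bar> * indicator {y. inner u (y - z) \<le> 0} x \<partial>P) /
     (\<integral>x. \<bar>inner u (x - z)\<bar> \<partial>P))"

definition mean_vector :: "(real ^ 'd) measure \<Rightarrow> real ^ 'd" where
  "mean_vector P = (\<integral>x. x \<partial>P)"

end

theory Submission
  imports Defs
begin

text \<open>Since \<open>\<bar>t\<bar> * indicator {t \<le> 0} = (\<bar>t\<bar> - t) / 2\<close>, the ratio that defines the depth equals, by
  linearity of the expectation,
  \<open>1 / 2 - inner u (mean_vector P - z) / (2 * E \<bar>inner u (Z - z)\<bar>)\<close> in each direction \<open>u\<close>
  (\<open>depth_ratio_eq\<close>); the denominator is positive because no hyperplane carries all the mass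
  (\<open>expected_abs_inner_pos\<close>). At the mean the correction vanishes for every \<open>u\<close>, so the depth is
  \<open>1 / 2\<close>. At any other point \<open>z\<close>, the unit vector pointing from \<open>z\<close> to the mean makes the
  correction positive, so a single direction already pushes the infimum strictly below \<open>1 / 2\<close>.\<close>

lemma integrable_inner_diff:
  fixes P :: "(real ^ 'd) measure"
  assumes "P \<in> nondegenerate_measures"
  shows "integrable P (\<lambda>x. inner u (x - z))"
proof -
  interpret prob_space P using assms by (simp add: nondegenerate_measures_def)
  have "integrable P (\<lambda>x. x)" using assms by (simp add: nondegenerate_measures_def)
  then show ?thesis
    by (intro integrable_inner_right Bochner_Integration.integrable_diff) auto
qed

lemma integral_inner_diff:
  fixes P :: "(real ^ 'd) measure"
  assumes "P \<in> nondegenerate_measures"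
  shows "(\<integral>x. inner u (x - z) \<partial>P) = inner u (mean_vector P - z)"
proof -
  interpret prob_space P using assms by (simp add: nondegenerate_measures_def)
  have "integrable P (\<lambda>x. x)" using assms by (simp add: nondegenerate_measures_def)
  then show ?thesis
    by (simp add: mean_vector_def prob_space)
qed

text \<open>A nonnegative function with vanishing integral vanishes almost everywhere; here this would
  put all the mass on the hyperplane through \<open>z\<close> orthogonal to \<open>u\<close>.\<close>

lemma expected_abs_inner_pos:
  fixes P :: "(real ^ 'd) measure"
  assumes P: "P \<in> nondegenerate_measures" and u: "u \<noteq> 0"
  shows "(\<integral>x. \<bar>inner u (x - z)\<bar> \<partial>P) > 0"
proof (rule ccontr)
  interpret prob_space P using P by (simp add: nondegenerate_measures_def)
  have [measurable_cong]: "sets P = sets borel"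
    using P by (simp add: nondegenerate_measures_def)
  have int: "integrable P (\<lambda>x. \<bar>inner u (x - z)\<bar>)"
    using integrable_inner_diff[OF P] by simp
  assume "\<not> ?thesis"
  moreover have "(\<integral>x. \<bar>inner u (x - z)\<bar> \<partial>P) \<ge> 0" by simp
  ultimately have "(\<integral>x. \<bar>inner u (x - z)\<bar> \<partial>P) = 0" by linarith
  then have "AE x in P. \<bar>inner u (x - z)\<bar> = 0"
    using integral_nonneg_eq_0_iff_AE[OF int] by simp
  then have "AE x in P. x \<in> {x. inner u x = inner u z}"
    by (simp add: inner_diff_right)
  moreover have "{x. inner u x = inner u z} \<in> sets P"
    using P by (simp add: nondegenerate_measures_def closed_hyperplane borel_closed)
  ultimately have "measure P {x. inner u x = inner u z} = 1"
    by (simp add: prob_eq_1)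
  then show False
    using P u by (simp add: nondegenerate_measures_def)
qed

lemma depth_ratio_eq:
  fixes P :: "(real ^ 'd) measure"
  assumes P: "P \<in> nondegenerate_measures" and u: "u \<noteq> 0"
  shows "(\<integral>x. \<bar>inner u (x - z)\<bar> * indicator {y. inner u (y - z) \<le> 0} x \<partial>P) /
      (\<integral>x. \<bar>inner u (x - z)\<bar> \<partial>P) =
    1 / 2 - inner u (mean_vector P - z) / (2 * (\<integral>x. \<bar>inner u (x - z)\<bar> \<partial>P))"
proof -
  have int: "integrable P (\<lambda>x. inner u (x - z))"
    by (rule integrable_inner_diff[OF P])
  have "(\<integral>x. \<bar>inner u (x - z)\<bar> * indicator {y. inner u (y - z) \<le> 0} x \<partial>P) =
      (\<integral>x. (\<bar>inner u (x - z)\<bar> - inner u (x - z)) / 2 \<partial>P)"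
    by (rule Bochner_Integration.integral_cong) (auto simp: indicator_def)
  also have "\<dots> = ((\<integral>x. \<bar>inner u (x - z)\<bar> \<partial>P) - (\<integral>x. inner u (x - z) \<partial>P)) / 2"
    using int by (simp del: inner_diff_right)
  finally show ?thesis
    using expected_abs_inner_pos[OF P u, of z] integral_inner_diff[OF P, of u z]
    by (simp add: field_simps)
qed

lemma expectile_depth_mean:
  fixes P :: "(real ^ 'd) measure"
  assumes P: "P \<in> nondegenerate_measures"
  shows "expectile_depth (mean_vector P) P = 1 / 2"
proof -
  have "expectile_depth (mean_vector P) P = (INF u \<in> sphere (0 :: real ^ 'd) 1. 1 / 2)"
    unfolding expectile_depth_def
  proof (rule INF_cong[OF refl])
    fix u :: "real ^ 'd"
    assume "u \<in> sphere 0 1"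
    then have "u \<noteq> 0" by auto
    from depth_ratio_eq[OF P this, of "mean_vector P"]
    show "(\<integral>x. \<bar>inner u (x - mean_vector P)\<bar> *
          indicator {y. inner u (y - mean_vector P) \<le> 0} x \<partial>P) /
        (\<integral>x. \<bar>inner u (x - mean_vector P)\<bar> \<partial>P) = 1 / 2"
      by simp
  qed
  then show ?thesis by simp
qed

lemma expectile_depth_less_half:
  fixes P :: "(real ^ 'd) measure"
  assumes P: "P \<in> nondegenerate_measures" and z: "z \<noteq> mean_vector P"
  shows "expectile_depth z P < 1 / 2"
proof -
  define u where "u = sgn (mean_vector P - z)"
  have u: "u \<in> sphere 0 1" "u \<noteq> 0"
    using z by (auto simp: u_def norm_sgn sgn_zero_iff)
  have "inner u (mean_vector P - z) = norm (mean_vector P - z)"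
    by (simp add: u_def sgn_div_norm flip: power2_norm_eq_inner)
      (use z in \<open>simp add: power2_eq_square field_simps\<close>)
  then have pos: "inner u (mean_vector P - z) > 0"
    using z by simp
  have "expectile_depth z P \<le>
      (\<integral>x. \<bar>inner u (x - z)\<bar> * indicator {y. inner u (y - z) \<le> 0} x \<partial>P) /
      (\<integral>x. \<bar>inner u (x - z)\<bar> \<partial>P)"
    unfolding expectile_depth_def
    \<comment> \<open>A real infimum lies below its members only for sets bounded below; the ratios are
      nonnegative.\<close>
    by (rule cINF_lower[OF bdd_belowI2[where m = 0] u(1)]) simp
  also have "\<dots> < 1 / 2"
    using pos expected_abs_inner_pos[OF P u(2), of z] by (simp add: depth_ratio_eq[OF P u(2)])
  finally show ?thesis .
qed

theorem theorem5p1: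
  fixes P :: "(real ^ 'd) measure"
  assumes "P \<in> nondegenerate_measures"
  shows "(\<forall>z. z \<noteq> mean_vector P \<longrightarrow> expectile_depth z P < expectile_depth (mean_vector P) P) \<and>
    expectile_depth (mean_vector P) P = 1 / 2"
  using expectile_depth_mean[OF assms] expectile_depth_less_half[OF assms] by metis

end
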